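(* Let $(X,d,\preccurlyeq)$ be a sequentially increasingly right $K$-complete preordered quasi-metric space and let $\varphi:X\to\mathbb{R}\cup\{\infty\}$ be a proper, bounded below, increasingly lsc function. Suppose that for every sequence $(x_n)_{n\in\mathbb{N}}$ in $X$ and every $x\in X$: if $x_n\preccurlyeq x_{n+1}$ for all $n\in\mathbb{N}$ and $x_n\xrightarrow{d}x$, then $x_n\preccurlyeq x$ for all $n\in\mathbb{N}$. For $x\in X$ put $S(x)=\{y\in X: x\preccurlyeq y \text{ and } \varphi(y)+d(y,x)\le\varphi(x)\}$. If for every $x\in\operatorname{dom}\varphi$ the condition $$\varphi(x)>\inf\varphi(X)\ \Longrightarrow\ \exists y\in S(x),\ \varphi(y)<\varphi(x)$$ holds, then $\varphi$ attains its minimum on $X$, i.e., there exists $z\in X$ such that $\varphi(z)=\inf\varphi(X)$.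
   Context: A quasi-metric on a set $X$ is a map $d:X\times X\to[0,\infty)$ with $d(x,x)=0$, $d(x,z)\le d(x,y)+d(y,z)$, and $d(x,y)=d(y,x)=0\Rightarrow x=y$ (symmetry is not required). The topology $\tau_d$ is generated by the balls $B_d(x,r)=\{y: d(x,y)<r\}$; all topological notions refer to $\tau_d$. Thus $x_n\xrightarrow{d}x$ means $d(x,x_n)\to0$. A preordered quasi-metric space $(X,d,\preccurlyeq)$ is a quasi-metric space with a reflexive and transitive relation $\preccurlyeq$. A sequence is increasing if $x_n\preccurlyeq x_{n+1}$ for all $n$. A sequence is right $K$-Cauchy if for every $\varepsilon>0$ there is $n_\varepsilon$ such that $d(x_m,x_n)<\varepsilon$ whenever $n_\varepsilon\le n<m$. The space is sequentially increasingly right $K$-complete if every increasing right $K$-Cauchy sequence is convergent (with respect to $\tau_d$). For $\varphi:X\to\mathbb{R}\cup\{\infty\}$, $\operatorname{dom}\varphi=\{x:\varphi(x)<\infty\}$; $\varphi$ is proper if $\operatorname{dom}\varphi\ne\emptyset$; $\varphi$ is increasingly lsc if $\varphi(x)\le\liminf_n\varphi(x_n)$ for every increasing sequence $(x_n)$ with $x_n\xrightarrow{d}x$. *)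

theory Defs
  imports "HOL-Analysis.Analysis"
begin

definition quasi_metric_on :: "'a set \<Rightarrow> ('a \<Rightarrow> 'a \<Rightarrow> real) \<Rightarrow> bool" where
  "quasi_metric_on X d \<longleftrightarrow>
     (\<forall>x\<in>X. \<forall>y\<in>X. 0 \<le> d x y) \<and>
     (\<forall>x\<in>X. d x x = 0) \<and>
     (\<forall>x\<in>X. \<forall>y\<in>X. \<forall>z\<in>X. d x z \<le> d x y + d y z) \<and>
     (\<forall>x\<in>X. \<forall>y\<in>X. d x y = 0 \<and> d y x = 0 \<longrightarrow> x = y)"

definition qm_ball :: "'a set \<Rightarrow> ('a \<Rightarrow> 'a \<Rightarrow> real) \<Rightarrow> 'a \<Rightarrow> real \<Rightarrow> 'a set" where
  "qm_ball X d x r = {y \<in> X. d x y < r}"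

definition qm_topology :: "'a set \<Rightarrow> ('a \<Rightarrow> 'a \<Rightarrow> real) \<Rightarrow> 'a topology" where
  "qm_topology X d = topology_generated_by {qm_ball X d x r | x r. x \<in> X \<and> 0 < r}"

definition preordered_quasi_metric_space ::
    "'a set \<Rightarrow> ('a \<Rightarrow> 'a \<Rightarrow> real) \<Rightarrow> ('a \<Rightarrow> 'a \<Rightarrow> bool) \<Rightarrow> bool" where
  "preordered_quasi_metric_space X d le \<longleftrightarrow>
     quasi_metric_on X d \<and> reflp_on X le \<and> transp_on X le"

definition increasing_seq :: "'a set \<Rightarrow> ('a \<Rightarrow> 'a \<Rightarrow> bool) \<Rightarrow> (nat \<Rightarrow> 'a) \<Rightarrow> bool" where
  "increasing_seq X le s \<longleftrightarrow> (\<forall>n. s n \<in> X) \<and> (\<forall>n. le (s n) (s (Suc n)))"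

text \<open>The larger index stands in the first argument of the quasi-metric.\<close>
definition right_K_Cauchy :: "('a \<Rightarrow> 'a \<Rightarrow> real) \<Rightarrow> (nat \<Rightarrow> 'a) \<Rightarrow> bool" where
  "right_K_Cauchy d s \<longleftrightarrow>
     (\<forall>\<epsilon>>0. \<exists>N. \<forall>n m. N \<le> n \<and> n < m \<longrightarrow> d (s m) (s n) < \<epsilon>)"

definition seq_increasingly_right_K_complete ::
    "'a set \<Rightarrow> ('a \<Rightarrow> 'a \<Rightarrow> real) \<Rightarrow> ('a \<Rightarrow> 'a \<Rightarrow> bool) \<Rightarrow> bool" where
  "seq_increasingly_right_K_complete X d le \<longleftrightarrow>
     (\<forall>s. increasing_seq X le s \<and> right_K_Cauchy d s \<longrightarrow>
        (\<exists>x\<in>X. limitin (qm_topology X d) s x sequentially))"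

definition effective_dom :: "'a set \<Rightarrow> ('a \<Rightarrow> ereal) \<Rightarrow> 'a set" where
  "effective_dom X \<phi> = {x \<in> X. \<phi> x < \<infinity>}"

definition increasingly_lsc ::
    "'a set \<Rightarrow> ('a \<Rightarrow> 'a \<Rightarrow> real) \<Rightarrow> ('a \<Rightarrow> 'a \<Rightarrow> bool) \<Rightarrow> ('a \<Rightarrow> ereal) \<Rightarrow> bool" where
  "increasingly_lsc X d le \<phi> \<longleftrightarrow>
     (\<forall>s. \<forall>x\<in>X. increasing_seq X le s \<and> limitin (qm_topology X d) s x sequentially \<longrightarrow>
        \<phi> x \<le> liminf (\<lambda>n. \<phi> (s n)))"

definition S_set ::
    "'a set \<Rightarrow> ('a \<Rightarrow> 'a \<Rightarrow> real) \<Rightarrow> ('a \<Rightarrow> 'a \<Rightarrow> bool) \<Rightarrow> ('a \<Rightarrow> ereal) \<Rightarrow> 'a \<Rightarrow> 'a set" where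
  "S_set X d le \<phi> x = {y \<in> X. le x y \<and> \<phi> y + ereal (d y x) \<le> \<phi> x}"

lemma topspace_qm_topology:
  assumes "quasi_metric_on X d"
  shows "topspace (qm_topology X d) = X"
proof -
  have "x \<in> qm_ball X d x 1" if "x \<in> X" for x
    using that assms by (auto simp: qm_ball_def quasi_metric_on_def)
  then have "X \<subseteq> \<Union>{qm_ball X d x r | x r. x \<in> X \<and> 0 < r}"
    using zero_less_one by blast
  then show ?thesis
    unfolding qm_topology_def topology_generated_by_topspace
    by (auto simp: qm_ball_def)
qed

lemma openin_qm_topology_ball_subset:
  assumes qm: "quasi_metric_on X d" and "openin (qm_topology X d) U" and "x \<in> U"
  shows "\<exists>r>0. qm_ball X d x r \<subseteq> U"
proof -
  have "generate_topology_on {qm_ball X d x r | x r. x \<in> X \<and> 0 < r} U"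
    using assms(2) by (simp add: qm_topology_def openin_topology_generated_by_iff)
  then show ?thesis using \<open>x \<in> U\<close>
  proof (induction rule: generate_topology_on.induct)
    case (Int a b)
    then obtain r s where "r > 0" "qm_ball X d x r \<subseteq> a" "s > 0" "qm_ball X d x s \<subseteq> b"
      by auto
    then show ?case
      by (intro exI[of _ "min r s"]) (auto simp: qm_ball_def)
  next
    case (UN K)
    then show ?case by (meson Union_iff Union_upper subset_trans)
  next
    case (Basis b)
    then obtain y r where y: "y \<in> X" and b: "b = qm_ball X d y r" by auto
    then have x: "x \<in> X" "d y x < r" using Basis by (auto simp: qm_ball_def)
    have "d y z \<le> d y x + d x z" if "z \<in> X" for z
      using qm y x that by (simp add: quasi_metric_on_def)
    then show ?case
      using x by (intro exI[of _ "r - d y x"]) (fastforce simp: b qm_ball_def)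
  qed auto
qed

lemma limitin_qm_topology_iff:
  assumes qm: "quasi_metric_on X d" and s: "\<And>n. s n \<in> X" and x: "x \<in> X"
  shows "limitin (qm_topology X d) s x sequentially \<longleftrightarrow> (\<lambda>n. d x (s n)) \<longlonglongrightarrow> 0"
proof
  assume L: "limitin (qm_topology X d) s x sequentially"
  show "(\<lambda>n. d x (s n)) \<longlonglongrightarrow> 0"
  proof (rule tendstoI)
    fix e :: real assume "e > 0"
    then have "openin (qm_topology X d) (qm_ball X d x e)"
      using x by (auto simp: qm_topology_def intro!: topology_generated_by_Basis)
    moreover have "x \<in> qm_ball X d x e"
      using qm x \<open>e > 0\<close> by (simp add: qm_ball_def quasi_metric_on_def)
    ultimately have "\<forall>\<^sub>F n in sequentially. s n \<in> qm_ball X d x e"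
      using L by (simp add: limitin_def)
    then show "\<forall>\<^sub>F n in sequentially. dist (d x (s n)) 0 < e"
      by eventually_elim (use qm x in \<open>auto simp: qm_ball_def quasi_metric_on_def\<close>)
  qed
next
  assume L: "(\<lambda>n. d x (s n)) \<longlonglongrightarrow> 0"
  show "limitin (qm_topology X d) s x sequentially"
    unfolding limitin_def
  proof (intro conjI allI impI)
    show "x \<in> topspace (qm_topology X d)" using x topspace_qm_topology[OF qm] by simp
  next
    fix U assume "openin (qm_topology X d) U \<and> x \<in> U"
    then obtain r where "r > 0" and r: "qm_ball X d x r \<subseteq> U"
      using openin_qm_topology_ball_subset[OF qm] by blast
    from order_tendstoD(2)[OF L \<open>r > 0\<close>] show "\<forall>\<^sub>F n in sequentially. s n \<in> U"
      by eventually_elim (use r s in \<open>auto simp: qm_ball_def\<close>)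
  qed
qed

end

theory Submission
  imports Defs
begin

text \<open>
  The sets \<open>S x\<close> are nested: \<open>y \<in> S x\<close> implies \<open>S y \<subseteq> S x\<close>. Pick \<open>s (n + 1) \<in> S (s n)\<close> whose
  value exceeds the infimum of \<open>\<phi>\<close> over \<open>S (s n)\<close> by at most \<open>1 / (n + 1)\<close>. Along this increasing
  sequence \<open>d (s m) (s n) \<le> \<phi> (s n) - \<phi> (s m)\<close>, so it is right K-Cauchy; its limit \<open>z\<close> lies in
  every \<open>S (s n)\<close>, and each \<open>y \<in> S z\<close> has \<open>\<phi> (s (n + 1)) \<le> \<phi> y + 1 / (n + 1)\<close>. Letting \<open>n\<close> grow,
  \<open>\<phi> z \<le> \<phi> y\<close>. Thus no descent from \<open>z\<close> is possible, and \<open>z\<close> is a minimiser.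
\<close>

lemma S_set_refl:
  assumes "preordered_quasi_metric_space X d le" "x \<in> X"
  shows "x \<in> S_set X d le \<phi> x"
  using assms by (auto simp: preordered_quasi_metric_space_def quasi_metric_on_def S_set_def reflp_on_def)

text \<open>The triangle inequality in the order \<open>d z x \<le> d z y + d y x\<close>, added to
  \<open>\<phi> z\<close>. The chain stays in \<open>ereal\<close>, so infinite values of
  \<open>\<phi>\<close> are covered.\<close>

lemma S_set_trans:
  assumes P: "preordered_quasi_metric_space X d le" and x: "x \<in> X"
    and y: "y \<in> S_set X d le \<phi> x" and z: "z \<in> S_set X d le \<phi> y"
  shows "z \<in> S_set X d le \<phi> x"
proof -
  have X: "y \<in> X" "z \<in> X" and le: "le x y" "le y z" using y z by (auto simp: S_set_def)
  have "le x z"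
    using P x X le unfolding preordered_quasi_metric_space_def by (meson transp_onD)
  moreover have "\<phi> z + ereal (d z x) \<le> \<phi> z + (ereal (d z y) + ereal (d y x))"
    using P x X by (intro add_left_mono) (simp add: preordered_quasi_metric_space_def quasi_metric_on_def)
  moreover have "\<phi> z + (ereal (d z y) + ereal (d y x)) \<le> \<phi> y + ereal (d y x)"
    using z unfolding S_set_def add.assoc[symmetric] by (intro add_right_mono) simp
  moreover have "\<phi> y + ereal (d y x) \<le> \<phi> x"
    using y by (simp add: S_set_def)
  ultimately show ?thesis using X by (auto simp: S_set_def)
qed

text \<open>Right K-Cauchy constrains only distances with the later index first, and exactly these
  are bounded by the drop of the potential \<open>f\<close>.\<close>

lemma right_K_Cauchy_if_dist_le_decrease:
  fixes f :: "nat \<Rightarrow> real"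
  assumes "\<And>m n. n < m \<Longrightarrow> d (s m) (s n) \<le> f n - f m" and "Cauchy f"
  shows "right_K_Cauchy d s"
  unfolding right_K_Cauchy_def
proof (intro allI impI)
  fix e :: real assume "e > 0"
  with \<open>Cauchy f\<close> obtain N where N: "\<And>m n. N \<le> m \<Longrightarrow> N \<le> n \<Longrightarrow> norm (f m - f n) < e"
    by (meson CauchyD)
  have "d (s m) (s n) < e" if "N \<le> n" "n < m" for m n
    using assms(1)[OF that(2)] N[of n m] that by auto
  then show "\<exists>N. \<forall>n m. N \<le> n \<and> n < m \<longrightarrow> d (s m) (s n) < e" by blast
qed

lemma exists_near_minimiser:
  fixes f :: "'a \<Rightarrow> real"
  assumes "A \<noteq> {}" "bdd_below (f ` A)" "0 < e"
  shows "\<exists>y\<in>A. \<forall>w\<in>A. f y \<le> f w + e"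
proof -
  obtain y where y: "y \<in> A" "f y < (INF w\<in>A. f w) + e"
    using assms cInf_lessD[of "f ` A" "(INF w\<in>A. f w) + e"] by auto
  have "f y \<le> f w + e" if "w \<in> A" for w
    using y cINF_lower[OF assms(2) that] by simp
  then show ?thesis using y by blast
qed

text \<open>The part that precedes any use of the descent condition: \<open>z\<close> is compared
  only with points of its own \<open>S_set\<close>; descent later turns this into a global
  minimum.\<close>

lemma exists_S_set_minimal:
  fixes X :: "'a set" and \<phi> :: "'a \<Rightarrow> ereal"
  assumes P: "preordered_quasi_metric_space X d le"
    and complete: "seq_increasingly_right_K_complete X d le"
    and proper: "effective_dom X \<phi> \<noteq> {}"
    and bounded_below: "\<forall>x\<in>X. ereal c \<le> \<phi> x"
    and lsc: "increasingly_lsc X d le \<phi>"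
    and limit_above: "\<forall>s. \<forall>x\<in>X. increasing_seq X le s \<and>
        limitin (qm_topology X d) s x sequentially \<longrightarrow> (\<forall>n. le (s n) x)"
  shows "\<exists>z\<in>effective_dom X \<phi>. \<forall>y\<in>S_set X d le \<phi> z. \<phi> z \<le> \<phi> y"
proof -
  define D where "D = effective_dom X \<phi>"
  \<comment> \<open>\<open>real_of_ereal\<close> sends infinite values to 0, so \<open>f\<close> is
    meaningful only on \<open>D\<close>.\<close>
  define f where "f x = real_of_ereal (\<phi> x)" for x
  define S where "S = S_set X d le \<phi>"
  have qm: "quasi_metric_on X d" using P by (simp add: preordered_quasi_metric_space_def)
  have DX: "x \<in> X" if "x \<in> D" for x using that by (simp add: D_def effective_dom_def)
  have f: "\<phi> x = ereal (f x)" if "x \<in> D" for x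
  proof -
    have "ereal c \<le> \<phi> x" "\<phi> x < \<infinity>"
      using that bounded_below by (auto simp: D_def effective_dom_def)
    then show ?thesis unfolding f_def by (cases "\<phi> x") auto
  qed
  have c: "c \<le> f x" if "x \<in> D" for x
    using bounded_below[rule_format, OF DX[OF that]] f[OF that] by simp
  \<comment> \<open>\<open>\<phi> y = \<infinity>\<close> would violate the inequality that defines
    \<open>S x\<close>, whose right side is finite. This keeps the sequence built below inside
    \<open>D\<close>.\<close>
  have SD: "y \<in> D" if x: "x \<in> D" and y: "y \<in> S x" for x y
    using y f[OF x] unfolding S_def S_set_def D_def effective_dom_def
    by (cases "\<phi> y") auto
  have Sf: "f y + d y x \<le> f x" "le x y" if x: "x \<in> D" and y: "y \<in> S x" for x y
    using y f[OF x] f[OF SD[OF x y]] by (auto simp: S_def S_set_def)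
  have SI: "y \<in> S x" if "x \<in> D" "y \<in> D" "le x y" "f y + d y x \<le> f x" for x y
    using that f[OF that(1)] f[OF that(2)] DX by (auto simp: S_def S_set_def)
  have step: "\<exists>y. y \<in> D \<and> y \<in> S x \<and> (\<forall>w\<in>S x. f y \<le> f w + 1 / Suc n)" if x: "x \<in> D" for x n
  proof -
    have "x \<in> S x" unfolding S_def using S_set_refl[OF P DX[OF x]] .
    moreover have "bdd_below (f ` S x)" using c SD[OF x] by (auto intro!: bdd_belowI)
    ultimately show ?thesis
      using exists_near_minimiser[of "S x" f "1 / Suc n"] SD[OF x] by (auto simp del: of_nat_Suc)
  qed
  have "\<exists>s. \<forall>n. s n \<in> D \<and>
      (s (Suc n) \<in> S (s n) \<and> (\<forall>w\<in>S (s n). f (s (Suc n)) \<le> f w + 1 / Suc n))"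
  proof (intro dependent_nat_choice)
    show "\<exists>x. x \<in> D" using proper by (auto simp: D_def)
  qed (rule step)
  then obtain s where sD: "\<And>n. s n \<in> D" and sS: "\<And>n. s (Suc n) \<in> S (s n)"
    and near: "\<And>n w. w \<in> S (s n) \<Longrightarrow> f (s (Suc n)) \<le> f w + 1 / Suc n"
    by blast
  have later: "s m \<in> S (s n)" if "n \<le> m" for m n
    using that
  proof (induction rule: dec_induct)
    case base
    then show ?case unfolding S_def using S_set_refl[OF P DX[OF sD]] .
  next
    case (step m)
    then show ?case
      using sS[of m] S_set_trans[OF P DX[OF sD]] unfolding S_def by blast
  qed
  have dist: "d (s m) (s n) \<le> f (s n) - f (s m)" if "n \<le> m" for m n
    using Sf(1)[OF sD later[OF that]] by simp
  have "decseq (\<lambda>n. f (s n))"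
  proof (rule decseq_SucI)
    fix n
    have "0 \<le> d (s (Suc n)) (s n)" using qm DX[OF sD] by (simp add: quasi_metric_on_def)
    then show "f (s (Suc n)) \<le> f (s n)" using dist[of n "Suc n"] by simp
  qed
  then obtain l where l: "(\<lambda>n. f (s n)) \<longlonglongrightarrow> l"
    using decseq_convergent[of "\<lambda>n. f (s n)" c] c[OF sD] by metis
  have inc: "increasing_seq X le s"
    using DX[OF sD] Sf(2)[OF sD sS] by (simp add: increasing_seq_def)
  have "right_K_Cauchy d s"
    using dist LIMSEQ_imp_Cauchy[OF l]
    by (intro right_K_Cauchy_if_dist_le_decrease[where f = "\<lambda>n. f (s n)"]) auto
  then obtain z where z: "z \<in> X" and lim: "limitin (qm_topology X d) s z sequentially"
    using complete inc unfolding seq_increasingly_right_K_complete_def by blast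
  have dz: "(\<lambda>n. d z (s n)) \<longlonglongrightarrow> 0"
    using limitin_qm_topology_iff[OF qm DX[OF sD] z] lim by simp
  have "(\<lambda>n. \<phi> (s n)) \<longlonglongrightarrow> ereal l"
    using l f[OF sD] by simp
  then have "liminf (\<lambda>n. \<phi> (s n)) = ereal l"
    by (intro lim_imp_Liminf) auto
  then have zl: "\<phi> z \<le> ereal l"
    using lsc inc lim z unfolding increasingly_lsc_def by metis
  \<comment> \<open>Semicontinuity has bounded \<open>\<phi> z\<close> by a real number, so real
    arithmetic with \<open>f z\<close> is available.\<close>
  then have zD: "z \<in> D" using z by (auto simp: D_def effective_dom_def)
  have fz: "f z \<le> l" using zl f[OF zD] by simp
  have zS: "z \<in> S (s n)" for n
  proof (rule SI[OF sD zD])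
    show "le (s n) z" using limit_above inc lim z by blast
    \<comment> \<open>A detour through \<open>s m\<close> with \<open>n\<close> fixed and
      \<open>m\<close> growing: convergence to \<open>z\<close> controls \<open>d z (s m)\<close>,
      with \<open>z\<close> in the first argument, as the triangle inequality requires.\<close>
    have "d z (s n) \<le> d z (s m) + (f (s n) - f (s m))" if "n \<le> m" for m
    proof -
      have "d z (s n) \<le> d z (s m) + d (s m) (s n)"
        using qm z DX[OF sD] by (simp add: quasi_metric_on_def)
      then show ?thesis using dist[OF that] by simp
    qed
    moreover have "(\<lambda>m. d z (s m) + (f (s n) - f (s m))) \<longlonglongrightarrow> 0 + (f (s n) - l)"
      by (intro tendsto_intros dz l)
    ultimately have "d z (s n) \<le> 0 + (f (s n) - l)"
      by (intro Lim_bounded2) auto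
    then show "f z + d z (s n) \<le> f (s n)" using fz by simp
  qed
  have "\<phi> z \<le> \<phi> y" if y: "y \<in> S z" for y
  proof -
    \<comment> \<open>This makes \<open>y\<close> a competitor at every stage of the choice of the
      sequence, so \<open>near\<close> applies to it for all \<open>n\<close>.\<close>
    have yS: "y \<in> S (s n)" for n
      using S_set_trans[OF P DX[OF sD]] zS y unfolding S_def by blast
    have "(\<lambda>n. f y + 1 / Suc n) \<longlonglongrightarrow> f y + 0"
      by (intro tendsto_intros LIMSEQ_Suc[OF lim_1_over_n])
    then have "l \<le> f y + 0"
      using LIMSEQ_le[OF LIMSEQ_Suc[OF l]] near[OF yS] by blast
    then show ?thesis using fz f[OF zD] f[OF SD[OF zD y]] by simp
  qed
  then show ?thesis using zD unfolding D_def S_def by blast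
qed

theorem theorem3p5:
  fixes X :: "'a set" and d :: "'a \<Rightarrow> 'a \<Rightarrow> real" and le :: "'a \<Rightarrow> 'a \<Rightarrow> bool"
    and \<phi> :: "'a \<Rightarrow> ereal"
  assumes "preordered_quasi_metric_space X d le"
    and "seq_increasingly_right_K_complete X d le"
    and "\<forall>x\<in>X. \<phi> x \<noteq> -\<infinity>"
    and proper: "effective_dom X \<phi> \<noteq> {}"
    and bounded_below: "\<exists>c::real. \<forall>x\<in>X. ereal c \<le> \<phi> x"
    and lsc: "increasingly_lsc X d le \<phi>"
    and limit_above: "\<forall>s. \<forall>x\<in>X. increasing_seq X le s \<and>
        limitin (qm_topology X d) s x sequentially \<longrightarrow> (\<forall>n. le (s n) x)"
    and descent: "\<forall>x\<in>effective_dom X \<phi>. \<phi> x > (INF u\<in>X. \<phi> u) \<longrightarrow>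
        (\<exists>y\<in>S_set X d le \<phi> x. \<phi> y < \<phi> x)"
  shows "\<exists>z\<in>X. \<phi> z = (INF u\<in>X. \<phi> u)"
proof -
  obtain c where c: "\<forall>x\<in>X. ereal c \<le> \<phi> x" using bounded_below by blast
  obtain z where z: "z \<in> effective_dom X \<phi>"
    and minimal: "\<forall>y\<in>S_set X d le \<phi> z. \<phi> z \<le> \<phi> y"
    using exists_S_set_minimal[OF assms(1,2) proper c lsc limit_above] by blast
  \<comment> \<open>Otherwise descent would yield a point of \<open>S_set X d le \<phi> z\<close>
    with a value below \<open>\<phi> z\<close>, against \<open>minimal\<close>.\<close>
  then have "\<not> (INF u\<in>X. \<phi> u) < \<phi> z" using z descent by (auto simp flip: not_less)
  moreover have "z \<in> X" using z by (simp add: effective_dom_def)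
  moreover have "(INF u\<in>X. \<phi> u) \<le> \<phi> z" using \<open>z \<in> X\<close> by (rule INF_lower)
  ultimately show ?thesis by (auto intro!: bexI[of _ z])
qed

end
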